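(* Let $A_1,\dots,A_m\in\mathbb{S}^n$ be such that $I_n,A_1,\dots,A_m$ are linearly independent. Let $\hat A_1,\dots,\hat A_m$ be the matrices obtained as follows: set $A_i'=A_i-\tfrac1n(\operatorname{tr}A_i)I_n$ for $i=1,\dots,m$; form the Gram matrix $G'=[\operatorname{tr}(A_i'A_j')]_{i,j=1}^m$; let $W=G'^{-1/2}$ be its symmetric inverse square root; and set $\hat A_i=\sum_{j=1}^m W_{ij}A_j'$ for $i=1,\dots,m$. Then: 1. $\operatorname{tr}\hat A_i=0$ for all $i=1,\dots,m$; 2. $\operatorname{tr}(\hat A_i\hat A_j)=\delta_{ij}$ for all $i,j=1,\dots,m$. Hence the matrices $\hat A_i$ are traceless and orthonormal (for the Frobenius inner product).
   Context: $\mathbb{S}^n$ is the space of real symmetric $n\times n$ matrices. $\delta_{ij}$ equals $1$ if $i=j$ and $0$ otherwise. If $G'=UDU^T$ is an eigendecomposition with $U$ orthogonal and $D$ diagonal, then $G'^{-1/2}=UD^{-1/2}U^T$. *)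

theory Defs
  imports "HOL-Analysis.Analysis"
begin

(* Linear independence of an indexed family: repeated members make a family
   dependent, which the library's set-based notion alone does not see. *)
definition independent_family :: "('i \<Rightarrow> 'a::real_vector) \<Rightarrow> bool" where
  "independent_family f \<longleftrightarrow> inj f \<and> independent (range f)"

definition diag_matrix :: "('m::finite \<Rightarrow> real) \<Rightarrow> real^'m^'m" where
  "diag_matrix d = (\<chi> i j. if i = j then d i else 0)"

(* W = U D^(-1/2) U^T for an eigendecomposition G = U D U^T. The power
   D^(-1/2) is meaningful only for positive eigenvalues, so these are required. *)
definition is_inv_sqrt :: "real^'m^'m \<Rightarrow> real^'m^'m \<Rightarrow> bool" where
  "is_inv_sqrt G W \<longleftrightarrow>
     (\<exists>U d. orthogonal_matrix U \<and> (\<forall>i. d i > 0) \<and>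
            G = U ** diag_matrix d ** transpose U \<and>
            W = U ** diag_matrix (\<lambda>i. d i powr (-1/2)) ** transpose U)"

(* As a definite description, this has a known value only once existence of an
   eigendecomposition with positive eigenvalues, and independence of its choice,
   have been established. *)
definition inv_sqrt :: "real^'m^'m \<Rightarrow> real^'m^'m" where
  "inv_sqrt G = (THE W. is_inv_sqrt G W)"

definition traceless_part :: "real^'n^'n \<Rightarrow> real^'n^'n" where
  "traceless_part A = A - (1 / real CARD('n) * trace A) *\<^sub>R mat 1"

definition trace_gram :: "('m::finite \<Rightarrow> real^'n^'n) \<Rightarrow> real^'m^'m" where
  "trace_gram A = (\<chi> i j. trace (A i ** A j))"

definition hat :: "('m::finite \<Rightarrow> real^'n^'n) \<Rightarrow> 'm \<Rightarrow> real^'n^'n" where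
  "hat A i =
     (\<Sum>j\<in>UNIV. inv_sqrt (trace_gram (\<lambda>k. traceless_part (A k))) $ i $ j
                *\<^sub>R traceless_part (A j))"

(* The library inner product on matrices is the Frobenius inner product. *)
lemma inner_eq_trace:
  fixes A B :: "real^'n^'n"
  shows "A \<bullet> B = trace (transpose A ** B)"
  unfolding inner_vec_def trace_def transpose_def matrix_matrix_mult_def
  by (simp, subst sum.swap, rule refl)

end

theory Submission
  imports Defs
begin

text \<open>
  Removing the traces keeps the family linearly independent: a vanishing combination of the
  traceless parts is a vanishing combination of \<open>I\<close> and the \<open>A\<^sub>i\<close>. The products
  \<open>A'\<^sub>i A'\<^sub>j\<close> of symmetric matrices have as traces the Frobenius inner products, so the
  matrix \<open>G'\<close> is the Gram matrix of an independent family and hence symmetric and positive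
  definite (\<open>gram_positive_definite\<close>). Its inverse square root \<open>W\<close> is symmetric with
  \<open>W G' W = I\<close>. As the Gram matrix of the family \<open>\<Sum>\<^sub>j W\<^sub>i\<^sub>j A'\<^sub>j\<close> is \<open>W G' W\<^sup>T\<close>, that
  family is orthonormal; it is traceless because the trace is linear.

  The inverse square root is given by a definite description, so both its existence and its
  uniqueness carry weight. Existence is the real spectral theorem
  (\<open>spectral_decomposition\<close>): on the orthogonal complement of a set of eigenvectors, a
  maximiser of the quadratic form on the unit sphere is one more eigenvector. Uniqueness
  (\<open>is_inv_sqrt_unique\<close>) holds because the transition matrix between two eigenbases only
  links equal eigenvalues, so that it also intertwines every function of the eigenvalues.
\<close>

section \<open>The spectral theorem for real symmetric matrices\<close>

text \<open>
  The eigenvector is a maximiser of \<open>x \<bullet> f x\<close> on the unit sphere of \<open>S\<close>. With maximum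
  \<open>c\<close>, the form \<open>c (x \<bullet> x) - x \<bullet> f x\<close> is nonnegative on \<open>S\<close> and vanishes at the maximiser, so
  its derivative there vanishes in all directions of \<open>S\<close>.
\<close>
lemma self_adjoint_eigenvector_exists:
  fixes f :: "'a::euclidean_space \<Rightarrow> 'a"
  assumes f: "linear f" and sa: "\<And>x y. x \<bullet> f y = f x \<bullet> y"
    and S: "subspace S" and inv: "\<And>x. x \<in> S \<Longrightarrow> f x \<in> S"
    and x0: "x0 \<in> S" "x0 \<noteq> 0"
  obtains v c where "v \<in> S" "norm v = 1" "f v = c *\<^sub>R v"
proof -
  let ?K = "S \<inter> sphere 0 1"
  have "compact ?K"
    by (intro closed_Int_compact closed_subspace S compact_sphere)
  moreover have "(1 / norm x0) *\<^sub>R x0 \<in> ?K"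
    using x0 S by (simp add: subspace_scale)
  then have "?K \<noteq> {}" by blast
  moreover have "continuous_on ?K (\<lambda>x. x \<bullet> f x)"
    by (intro continuous_intros linear_continuous_on) (use f in \<open>simp add: linear_conv_bounded_linear\<close>)
  ultimately obtain v where v: "v \<in> ?K" and vmax: "\<And>y. y \<in> ?K \<Longrightarrow> y \<bullet> f y \<le> v \<bullet> f v"
    using continuous_attains_sup[of ?K "\<lambda>x. x \<bullet> f x"] by blast
  define c where "c = v \<bullet> f v"
  define g where "g x = c * (x \<bullet> x) - x \<bullet> f x" for x
  have vS: "v \<in> S" and vn: "norm v = 1" using v by auto
  have g_nonneg: "g x \<ge> 0" if "x \<in> S" for x
  proof (cases "x = 0")
    case False
    have "(1 / norm x) *\<^sub>R x \<in> ?K" using that False S by (simp add: subspace_scale)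
    from vmax[OF this] have "(x \<bullet> f x) / (norm x * norm x) \<le> c"
      using f by (simp add: c_def linear_scale)
    then show ?thesis
      using False by (simp add: g_def field_simps dot_square_norm power2_eq_square)
  qed (simp add: g_def)
  have stationary: "w \<bullet> (c *\<^sub>R v - f v) = 0" if w: "w \<in> S" for w
  proof -
    define b where "b = w \<bullet> (c *\<^sub>R v - f v)"
    have expand: "g (v + t *\<^sub>R w) = 2 * t * b + t\<^sup>2 * g w" for t
    proof -
      have "v \<bullet> v = 1" using vn by (simp add: dot_square_norm)
      moreover have "v \<bullet> f w = w \<bullet> f v" by (metis sa inner_commute)
      moreover have "v \<bullet> w = w \<bullet> v" by (rule inner_commute)
      ultimately show ?thesis
        using f by (simp add: g_def b_def linear_add linear_scale inner_add_left inner_add_right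
            inner_diff_right c_def[symmetric] algebra_simps power2_eq_square)
    qed
    have nonneg: "0 \<le> 2 * t * b + t\<^sup>2 * g w" for t
      using g_nonneg[of "v + t *\<^sub>R w"] vS w S
      by (simp add: subspace_add subspace_scale expand)
    show ?thesis
    proof (rule ccontr)
      assume "w \<bullet> (c *\<^sub>R v - f v) \<noteq> 0"
      then have "b\<^sup>2 > 0" by (simp add: b_def)
      have gw: "0 \<le> g w" by (rule g_nonneg[OF w])
      \<comment> \<open>A step against the sign of the derivative, short enough for the linear term to win.\<close>
      define s where "s = g w + 1"
      define t where "t = - b / s"
      have s: "s > 0" and gs: "g w = s - 1" using gw by (auto simp: s_def)
      have "2 * t * b + t\<^sup>2 * g w = - (b\<^sup>2 * (s + 1) / s\<^sup>2)"
        using s unfolding gs by (simp add: t_def field_simps power2_eq_square)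
      also have "\<dots> < 0"
        using s \<open>b\<^sup>2 > 0\<close> by simp
      finally show False using nonneg[of t] by simp
    qed
  qed
  have "c *\<^sub>R v - f v \<in> S" using S vS inv by (simp add: subspace_diff subspace_scale)
  from stationary[OF this] have "f v = c *\<^sub>R v" by simp
  with vS vn show thesis by (rule that)
qed

text \<open>
  A largest orthonormal set of eigenvectors is a basis: otherwise its orthogonal complement is
  a nonzero subspace, invariant since \<open>f\<close> is self-adjoint, and contains a further eigenvector.
\<close>
lemma self_adjoint_orthonormal_eigenbasis:
  fixes f :: "'a::euclidean_space \<Rightarrow> 'a"
  assumes f: "linear f" and sa: "\<And>x y. x \<bullet> f y = f x \<bullet> y"
  obtains B where "finite B" "card B = DIM('a)" "pairwise orthogonal B"
    "\<And>b. b \<in> B \<Longrightarrow> norm b = 1" "\<And>b. b \<in> B \<Longrightarrow> \<exists>c. f b = c *\<^sub>R b"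
proof -
  define P where "P B \<longleftrightarrow> pairwise orthogonal B \<and> (\<forall>b\<in>B. norm b = 1 \<and> (\<exists>c. f b = c *\<^sub>R b))"
    for B :: "'a set"
  have bound: "independent B \<and> finite B \<and> card B \<le> DIM('a)" if "P B" for B
  proof -
    have "0 \<notin> B" using that by (force simp: P_def)
    then have "independent B"
      using that pairwise_orthogonal_independent by (auto simp: P_def)
    then show ?thesis using independent_bound by blast
  qed
  have "P {}" by (simp add: P_def)
  from ex_has_greatest_nat[of P, OF this, of card "DIM('a) + 1"]
  obtain B where B: "P B" and max: "\<And>C. P C \<Longrightarrow> card C \<le> card B"
    using bound by fastforce
  note b = bound[OF B]
  have "card B = DIM('a)"
  proof (rule ccontr)
    assume "card B \<noteq> DIM('a)"
    then have "dim B < DIM('a)" using b by (simp add: dim_eq_card_independent)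
    then obtain x where x: "x \<noteq> 0" "\<And>y. y \<in> span B \<Longrightarrow> orthogonal x y"
      using orthogonal_to_subspace_exists[of B] by metis
    define S where "S = {x. \<forall>b\<in>B. b \<bullet> x = 0}"
    have S: "subspace S" by (auto simp: S_def subspace_def inner_add_right)
    have xS: "x \<in> S"
      using x(2) by (auto simp: S_def orthogonal_def span_base inner_commute)
    have inv: "f y \<in> S" if "y \<in> S" for y
    proof -
      have "b \<bullet> f y = 0" if "b \<in> B" for b
      proof -
        obtain c where "f b = c *\<^sub>R b" using B \<open>b \<in> B\<close> by (auto simp: P_def)
        then show ?thesis using \<open>y \<in> S\<close> \<open>b \<in> B\<close> by (simp add: sa S_def)
      qed
      then show ?thesis by (simp add: S_def)
    qed
    obtain v c where v: "v \<in> S" "norm v = 1" "f v = c *\<^sub>R v"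
      using self_adjoint_eigenvector_exists[OF f sa S inv xS x(1)] by blast
    have "v \<notin> B"
    proof
      assume "v \<in> B"
      then have "v \<bullet> v = 0" using v(1) by (simp add: S_def)
      then show False using v(2) by simp
    qed
    have "P (insert v B)"
      using B v by (auto simp: P_def pairwise_insert orthogonal_def S_def inner_commute)
    from max[OF this] \<open>v \<notin> B\<close> b show False by simp
  qed
  with B b that show thesis by (auto simp: P_def)
qed

lemma mult_diag_matrix: "(U ** diag_matrix d) $ i $ j = U $ i $ j * d j"
  by (simp add: matrix_matrix_mult_def diag_matrix_def if_distrib cong: if_cong)

lemma diag_matrix_mult: "(diag_matrix d ** U) $ i $ j = d i * U $ i $ j"
  by (simp add: matrix_matrix_mult_def diag_matrix_def if_distrib if_distribR cong: if_cong)

lemma transpose_diag_matrix: "transpose (diag_matrix d) = diag_matrix d"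
  by (simp add: vec_eq_iff transpose_def diag_matrix_def)

theorem spectral_decomposition:
  fixes G :: "real^'m^'m"
  assumes sym: "transpose G = G"
  obtains U d where "orthogonal_matrix U" "G = U ** diag_matrix d ** transpose U"
    "\<And>i. G *v column i U = d i *\<^sub>R column i U"
proof -
  have sa: "x \<bullet> (G *v y) = (G *v x) \<bullet> y" for x y
    by (metis dot_lmul_matrix sym transpose_matrix_vector)
  obtain B where B: "finite B" "card B = DIM(real^'m)" "pairwise orthogonal B"
    "\<And>b. b \<in> B \<Longrightarrow> norm b = 1" "\<And>b. b \<in> B \<Longrightarrow> \<exists>c. G *v b = c *\<^sub>R b"
    using self_adjoint_orthonormal_eigenbasis[OF matrix_vector_mul_linear sa] by blast
  obtain u where u: "bij_betw u (UNIV :: 'm set) B"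
    using finite_same_card_bij[of "UNIV :: 'm set" B] B by auto
  define U where "U = (\<chi> r i. u i $ r)"
  have col: "column i U = u i" for i by (simp add: U_def column_def vec_eq_iff)
  have uB: "u i \<in> B" for i using u by (auto simp: bij_betw_def)
  obtain d where d: "\<And>i. G *v u i = d i *\<^sub>R u i" using B(5)[OF uB] by metis
  have "u i \<noteq> u j" if "i \<noteq> j" for i j
    using u that by (auto simp: bij_betw_def inj_on_def)
  then have U: "orthogonal_matrix U"
    using B uB by (auto simp: orthogonal_matrix_orthonormal_columns col pairwise_def)
  have "G ** U = U ** diag_matrix d"
  proof -
    have "(G ** U) $ r $ i = U $ r $ i * d i" for r i
      using d[of i]
      by (simp add: vec_eq_iff U_def matrix_matrix_mult_def matrix_vector_mult_def)
    then show ?thesis by (simp add: vec_eq_iff mult_diag_matrix)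
  qed
  then have "G = U ** diag_matrix d ** transpose U"
    using U by (metis matrix_mul_assoc matrix_mul_rid orthogonal_matrix_def)
  with U d col show thesis by (intro that) auto
qed

section \<open>The inverse square root of a positive definite matrix\<close>

lemma is_inv_sqrt_exists:
  fixes G :: "real^'m^'m"
  assumes sym: "transpose G = G" and pos: "\<And>x. x \<noteq> 0 \<Longrightarrow> x \<bullet> (G *v x) > 0"
  shows "\<exists>W. is_inv_sqrt G W"
proof -
  obtain U d where U: "orthogonal_matrix U" "G = U ** diag_matrix d ** transpose U"
    and d: "\<And>i. G *v column i U = d i *\<^sub>R column i U"
    using spectral_decomposition[OF sym] by blast
  have "d i > 0" for i
  proof -
    have n: "norm (column i U) = 1" using U by (simp add: orthogonal_matrix_orthonormal_columns)
    then have "column i U \<noteq> 0" by auto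
    from pos[OF this] show ?thesis using n by (simp add: d dot_square_norm)
  qed
  with U show ?thesis by (auto simp: is_inv_sqrt_def)
qed

text \<open>
  For two eigendecompositions \<open>U D U\<^sup>T = V E V\<^sup>T\<close>, the transition matrix \<open>M = U\<^sup>T V\<close>
  satisfies \<open>D M = M E\<close>, that is, \<open>d\<^sub>i = e\<^sub>j\<close> wherever \<open>M\<^sub>i\<^sub>j \<noteq> 0\<close>. The same then holds for
  \<open>d\<^sub>i\<close> and \<open>e\<^sub>j\<close> raised to any power.
\<close>
lemma is_inv_sqrt_unique:
  assumes "is_inv_sqrt G W" "is_inv_sqrt G W'"
  shows "W = W'"
proof -
  obtain U d where U: "orthogonal_matrix U" and GU: "G = U ** diag_matrix d ** transpose U"
    and WU: "W = U ** diag_matrix (\<lambda>i. d i powr (-1/2)) ** transpose U"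
    using assms(1) by (auto simp: is_inv_sqrt_def)
  obtain V e where V: "orthogonal_matrix V" and GV: "G = V ** diag_matrix e ** transpose V"
    and WV: "W' = V ** diag_matrix (\<lambda>i. e i powr (-1/2)) ** transpose V"
    using assms(2) by (auto simp: is_inv_sqrt_def)
  let ?D = "diag_matrix (\<lambda>i. d i powr (-1/2))" and ?E = "diag_matrix (\<lambda>i. e i powr (-1/2))"
  define M where "M = transpose U ** V"
  have UU: "transpose U ** U = mat 1" "U ** transpose U = mat 1"
    and VV: "transpose V ** V = mat 1" "V ** transpose V = mat 1"
    using U V by (auto simp: orthogonal_matrix_def)
  have "diag_matrix d ** M = transpose U ** G ** V"
    by (metis GU M_def UU(1) matrix_mul_assoc matrix_mul_lid)
  also have "\<dots> = M ** diag_matrix e"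
    by (metis GV M_def VV(1) matrix_mul_assoc matrix_mul_rid)
  finally have "d i * M $ i $ j = M $ i $ j * e j" for i j
    by (metis diag_matrix_mult mult_diag_matrix)
  then have "M $ i $ j = 0 \<or> d i = e j" for i j
    by (metis mult.commute mult_cancel_left)
  then have "d i powr (-1/2) * M $ i $ j = M $ i $ j * e j powr (-1/2)" for i j
    by (metis mult.commute mult_zero_left)
  then have DM: "?D ** M = M ** ?E"
    by (simp add: vec_eq_iff diag_matrix_mult mult_diag_matrix)
  have "W = U ** (?D ** M) ** transpose V"
    by (metis WU M_def VV(2) matrix_mul_assoc matrix_mul_rid)
  also have "\<dots> = W'"
    unfolding DM by (metis WV M_def UU(2) matrix_mul_assoc matrix_mul_lid)
  finally show ?thesis .
qed

lemma is_inv_sqrt_inv_sqrt: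
  assumes "transpose G = G" and "\<And>x. x \<noteq> 0 \<Longrightarrow> x \<bullet> (G *v x) > 0"
  shows "is_inv_sqrt G (inv_sqrt G)"
  unfolding inv_sqrt_def
  using is_inv_sqrt_exists[OF assms] is_inv_sqrt_unique by (metis theI)

lemma is_inv_sqrt_symmetric:
  assumes "is_inv_sqrt G W"
  shows "transpose W = W"
  using assms
  by (auto simp: is_inv_sqrt_def matrix_transpose_mul transpose_diag_matrix matrix_mul_assoc)

lemma is_inv_sqrt_whitens:
  assumes "is_inv_sqrt G W"
  shows "W ** G ** W = mat 1"
proof -
  obtain U d where U: "orthogonal_matrix U" and d: "\<And>i. d i > 0"
    and G: "G = U ** diag_matrix d ** transpose U"
    and W: "W = U ** diag_matrix (\<lambda>i. d i powr (-1/2)) ** transpose U"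
    using assms by (auto simp: is_inv_sqrt_def)
  let ?D = "diag_matrix (\<lambda>i. d i powr (-1/2))"
  have UU: "transpose U ** U = mat 1" "U ** transpose U = mat 1"
    using U by (auto simp: orthogonal_matrix_def)
  have cancel: "X ** transpose U ** U = X" for X :: "real^'a^'a"
    by (metis UU(1) matrix_mul_assoc matrix_mul_rid)
  have "d i powr (-1/2) * d i * d i powr (-1/2) = 1" for i
  proof -
    have "d i powr (-1/2) * d i powr (-1/2) = d i powr (-1)"
      by (simp flip: powr_add)
    then show ?thesis using d[of i] by (simp add: powr_minus_divide mult.assoc mult.left_commute)
  qed
  then have DGD: "?D ** diag_matrix d ** ?D = mat 1"
    by (auto simp: vec_eq_iff mult_diag_matrix) (auto simp: diag_matrix_def mat_def)
  have "W ** G ** W = U ** (?D ** diag_matrix d ** ?D) ** transpose U"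
    by (simp add: W G matrix_mul_assoc cancel)
  also have "\<dots> = mat 1" by (simp only: DGD matrix_mul_rid UU)
  finally show ?thesis .
qed

section \<open>Orthonormalisation by the Gram matrix\<close>

lemma gram_quadratic_form:
  fixes v :: "'m::finite \<Rightarrow> 'a::real_inner"
  shows "x \<bullet> ((\<chi> i j. v i \<bullet> v j) *v x) = (norm (\<Sum>i\<in>UNIV. x $ i *\<^sub>R v i))\<^sup>2"
  by (simp add: power2_norm_eq_inner inner_sum_left inner_sum_right inner_vec_def
      matrix_vector_mult_def sum_distrib_left ac_simps inner_commute)

lemma gram_positive_definite:
  fixes v :: "'m::finite \<Rightarrow> 'a::real_inner"
  assumes indep: "\<And>x. (\<Sum>i\<in>UNIV. x $ i *\<^sub>R v i) = 0 \<Longrightarrow> x = (0::real^'m)"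
    and "x \<noteq> 0"
  shows "x \<bullet> ((\<chi> i j. v i \<bullet> v j) *v x) > 0"
  using assms by (auto simp: gram_quadratic_form)

lemma inner_linear_combinations_gram:
  fixes v :: "'m::finite \<Rightarrow> 'a::real_inner"
  shows "(\<Sum>k\<in>UNIV. W $ i $ k *\<^sub>R v k) \<bullet> (\<Sum>l\<in>UNIV. W $ j $ l *\<^sub>R v l)
       = (W ** (\<chi> k l. v k \<bullet> v l) ** transpose W) $ i $ j"
  by (simp add: inner_sum_left inner_sum_right matrix_matrix_mult_def transpose_def
      sum_distrib_left sum_distrib_right ac_simps)

text \<open>This is the symmetric orthogonalisation, or Loewdin orthogonalisation.\<close>
lemma inv_sqrt_gram_orthonormalises:
  fixes v :: "'m::finite \<Rightarrow> 'a::real_inner"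
  assumes indep: "\<And>x. (\<Sum>i\<in>UNIV. x $ i *\<^sub>R v i) = 0 \<Longrightarrow> x = (0::real^'m)"
    and G: "G = (\<chi> i j. v i \<bullet> v j)"
  shows "(\<Sum>k\<in>UNIV. inv_sqrt G $ i $ k *\<^sub>R v k) \<bullet> (\<Sum>l\<in>UNIV. inv_sqrt G $ j $ l *\<^sub>R v l)
       = (if i = j then 1 else 0)"
proof -
  have "transpose G = G" by (simp add: G transpose_def vec_eq_iff inner_commute)
  then have "is_inv_sqrt G (inv_sqrt G)"
    using gram_positive_definite[OF indep] G by (intro is_inv_sqrt_inv_sqrt) auto
  then show ?thesis
    unfolding inner_linear_combinations_gram G[symmetric]
    by (simp add: is_inv_sqrt_symmetric is_inv_sqrt_whitens mat_def)
qed

section \<open>Traceless symmetric matrices\<close>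

lemma trace_scaleR: "trace (c *\<^sub>R A) = c * trace (A :: real^'n^'n)"
  by (simp add: trace_def sum_distrib_left)

lemma trace_sum: "trace (\<Sum>i\<in>S. A i) = (\<Sum>i\<in>S. trace (A i :: real^'n^'n))"
  unfolding trace_def by (simp add: sum.swap[of _ S])

lemma trace_traceless_part: "trace (traceless_part A) = 0"
  by (simp add: traceless_part_def trace_sub trace_scaleR trace_I)

lemma transpose_sum_scaleR:
  fixes A :: "'i \<Rightarrow> real^'n^'m"
  shows "transpose (\<Sum>i\<in>S. c i *\<^sub>R A i) = (\<Sum>i\<in>S. c i *\<^sub>R transpose (A i))"
  by (simp add: vec_eq_iff transpose_def)

lemma transpose_traceless_part:
  assumes "transpose A = A"
  shows "transpose (traceless_part A) = traceless_part A"
proof -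
  have "A $ j $ i = A $ i $ j" for i j
    using assms by (metis transpose_def vec_lambda_beta)
  then show ?thesis
    by (simp add: traceless_part_def transpose_def vec_eq_iff mat_def)
qed

lemma independent_family_sum_eq_0D:
  fixes f :: "'i::finite \<Rightarrow> 'a::real_vector"
  assumes f: "independent_family f" and "(\<Sum>i\<in>UNIV. c i *\<^sub>R f i) = 0"
  shows "c i = 0"
proof -
  have inj: "inj f" and ind: "independent (range f)"
    using f by (auto simp: independent_family_def)
  have "(\<Sum>y\<in>range f. c (inv f y) *\<^sub>R y) = 0"
    using assms(2) inj by (simp add: sum.reindex)
  then have "c (inv f (f i)) = 0"
    using independentD[OF ind, of "range f" "\<lambda>y. c (inv f y)" "f i"] by simp
  then show ?thesis using inj by simp
qed

text \<open>
  A vanishing combination of traceless parts is one of the identity and the \<open>A i\<close>, where the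
  identity takes up the subtracted traces.
\<close>
lemma traceless_parts_independent:
  fixes A :: "'m::finite \<Rightarrow> real^'n^'n"
  assumes ind: "independent_family (case_option (mat 1) A)"
    and x: "(\<Sum>i\<in>UNIV. x $ i *\<^sub>R traceless_part (A i)) = 0"
  shows "x = 0"
proof -
  define c where
    "c = case_option (- (\<Sum>i\<in>UNIV. x $ i * (1 / real CARD('n) * trace (A i)))) (\<lambda>i. x $ i)"
  have "(\<Sum>p\<in>UNIV. c p *\<^sub>R case_option (mat 1) A p)
      = (\<Sum>i\<in>UNIV. x $ i *\<^sub>R traceless_part (A i))"
    by (simp add: UNIV_option_conv sum.reindex c_def traceless_part_def scaleR_diff_right
        sum_subtractf scaleR_sum_left)
  then have "c (Some i) = 0" for i
    using independent_family_sum_eq_0D[OF ind] x by metis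
  then show ?thesis by (simp add: c_def vec_eq_iff)
qed

theorem theorem2:
  fixes A :: "'m::finite \<Rightarrow> real^'n^'n"
  assumes symmetric: "\<And>i. transpose (A i) = A i"
    and independent: "independent_family (case_option (mat 1) A)"
  shows "(\<forall>i. trace (hat A i) = 0) \<and>
         (\<forall>i j. trace (hat A i ** hat A j) = (if i = j then 1 else 0)) \<and>
         (\<forall>i j. hat A i \<bullet> hat A j = (if i = j then 1 else 0))"
proof -
  define v where "v = (\<lambda>i. traceless_part (A i))"
  have hat: "hat A i = (\<Sum>j\<in>UNIV. inv_sqrt (trace_gram v) $ i $ j *\<^sub>R v j)" for i
    by (simp add: hat_def v_def)
  have v_sym: "transpose (v i) = v i" for i
    by (simp add: v_def transpose_traceless_part symmetric)
  then have gram: "trace_gram v = (\<chi> i j. v i \<bullet> v j)"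
    by (simp add: trace_gram_def inner_eq_trace)
  have indep: "x = 0" if "(\<Sum>i\<in>UNIV. x $ i *\<^sub>R v i) = 0" for x :: "real^'m"
    using traceless_parts_independent[OF independent] that by (simp add: v_def)
  have orthonormal: "hat A i \<bullet> hat A j = (if i = j then 1 else 0)" for i j
    unfolding hat by (rule inv_sqrt_gram_orthonormalises[OF indep gram])
  have "transpose (hat A i) = hat A i" for i
    by (simp add: hat transpose_sum_scaleR v_sym)
  then have "trace (hat A i ** hat A j) = hat A i \<bullet> hat A j" for i j
    by (simp add: inner_eq_trace)
  moreover have "trace (hat A i) = 0" for i
    by (simp add: hat trace_sum trace_scaleR v_def trace_traceless_part)
  ultimately show ?thesis by (simp add: orthonormal)
qed

end
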